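(* Let $n\ge1$ and let $U$ be the commutative Pauli-$Z$ circuit on $n$ qubits that includes all possible rotations, i.e. $N=2^n-1$ and $Q_1,\dots,Q_N$ are all the non-empty subsets of $\{1,\dots,n\}$ (see the context). Then for every positive integer $t$ the frame potential is the expected value of a multinomial coefficient: $$\mathcal{F}_U(t)=\frac{1}{2^{nt}}\,\mathbb{E}\left[\binom{t}{B^{(1)}_t\,\cdots\,B^{(2^n)}_t}\right],$$ where $B_t=(B^{(1)}_t,\dots,B^{(2^n)}_t)$ is a random walk started at $0$ whose independent increments are uniformly distributed on the canonical basis of $\mathbb{R}^{2^n}$.
   Context: Pauli-$Z$ circuit: the initial state is $\psi_0=|+\rangle^{\otimes n}$, i.e. the vector in $\mathbb{C}^{2^n}$ with all entries $2^{-n/2}$. For $j=1,\dots,N$, $H_j=\bigotimes_{m=1}^n O^{(j)}_m$ with $O^{(j)}_m=Z=\mathrm{diag}(1,-1)$ if $m\in Q_j$ and $O^{(j)}_m=I_2$ otherwise. The circuit is $U(\boldsymbol{\theta})=e^{i(\theta_1H_1+\dots+\theta_NH_N)}$, $\boldsymbol{\theta}\in[-\pi,\pi]^N$. Frame potential: $$\mathcal{F}_U(t)=\frac{1}{(2\pi)^{2N}}\int_{[-\pi,\pi]^{2N}}|\langle\psi_0|U(\boldsymbol{\theta})^\dagger U(\boldsymbol{\theta}')|\psi_0\rangle|^{2t}\,d\boldsymbol{\theta}\,d\boldsymbol{\theta}'.$$ Multinomial coefficient: $\binom{t}{b_1\cdots b_r}=\frac{t!}{b_1!\cdots b_r!}$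 for non-negative integers with $b_1+\dots+b_r=t$. *)

theory Defs
  imports
    "HOL-Probability.Probability"
    "Jordan_Normal_Form.Schur_Decomposition"
begin

text \<open>Square matrices over the complex numbers are Jordan_Normal_Form matrices, with rows and
  columns indexed from 0. Qubits are numbered from 1 to n, rotations from 1 to N.\<close>

definition kron :: "complex mat \<Rightarrow> complex mat \<Rightarrow> complex mat" where
  "kron A B = mat (dim_row A * dim_row B) (dim_col A * dim_col B)
     (\<lambda>(i, j). A $$ (i div dim_row B, j div dim_col B) * B $$ (i mod dim_row B, j mod dim_col B))"

definition tensor_mats :: "complex mat list \<Rightarrow> complex mat" where
  "tensor_mats As = foldr kron As (1\<^sub>m 1)"

definition mat_exp :: "complex mat \<Rightarrow> complex mat" where
  "mat_exp A = mat (dim_row A) (dim_row A) (\<lambda>(i, j). \<Sum>k. (A ^\<^sub>m k) $$ (i, j) / fact k)"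

definition pauli_Z :: "complex mat" where
  "pauli_Z = mat_of_rows_list 2 [[1, 0], [0, -1]]"

definition pauli_Z_string :: "nat \<Rightarrow> nat set \<Rightarrow> complex mat" where
  "pauli_Z_string n S = tensor_mats (map (\<lambda>m. if m \<in> S then pauli_Z else 1\<^sub>m 2) [1..<n + 1])"

definition pauli_Z_circuit ::
  "nat \<Rightarrow> nat \<Rightarrow> (nat \<Rightarrow> nat set) \<Rightarrow> (nat \<Rightarrow> real) \<Rightarrow> complex mat" where
  "pauli_Z_circuit n N Q \<theta> =
     mat_exp (\<i> \<cdot>\<^sub>m foldr (\<lambda>j A. complex_of_real (\<theta> j) \<cdot>\<^sub>m pauli_Z_string n (Q j) + A)
                     [1..<N + 1] (0\<^sub>m (2 ^ n) (2 ^ n)))"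

definition plus_state :: "nat \<Rightarrow> complex Matrix.vec" where
  "plus_state n = Matrix.vec (2 ^ n) (\<lambda>_. complex_of_real (2 powr (- real n / 2)))"

text \<open>The parameter box is integrated over with respect to the product Lebesgue measure on
  functions on \<open>{1..N}\<close>. The scalar product \<open>v \<bullet>c w\<close> is conjugate-linear in \<open>w\<close>, so that
  \<open>(A *\<^sub>v \<psi>) \<bullet>c \<psi>\<close> is the bracket of \<open>\<psi>\<close>, \<open>A\<close>, \<open>\<psi>\<close>.\<close>

definition param_box :: "nat \<Rightarrow> (nat \<Rightarrow> real) set" where
  "param_box N = (\<Pi>\<^sub>E j\<in>{1..N}. {-pi..pi})"

definition frame_potential ::
  "nat \<Rightarrow> complex Matrix.vec \<Rightarrow> ((nat \<Rightarrow> real) \<Rightarrow> complex mat) \<Rightarrow> nat \<Rightarrow> real" where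
  "frame_potential N \<psi> U t =
     1 / (2 * pi) ^ (2 * N) *
     set_lebesgue_integral
       ((\<Pi>\<^sub>M j\<in>{1..N}. lborel) \<Otimes>\<^sub>M (\<Pi>\<^sub>M j\<in>{1..N}. lborel))
       (param_box N \<times> param_box N)
       (\<lambda>(\<theta>, \<theta>'). cmod (((mat_adjoint (U \<theta>) * U \<theta>') *\<^sub>v \<psi>) \<bullet>c \<psi>) ^ (2 * t))"

text \<open>Meant for \<open>finite I\<close> and \<open>(\<Sum>i\<in>I. b i) = t\<close>.\<close>

definition multinomial :: "nat \<Rightarrow> 'i set \<Rightarrow> ('i \<Rightarrow> nat) \<Rightarrow> real" where
  "multinomial t I b = fact t / (\<Prod>i\<in>I. fact (b i))"

text \<open>Vectors of the d-dimensional real space are functions on \<open>{1..d}\<close>, \<open>undefined\<close> elsewhere, which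
  makes them the points of \<open>\<Pi>\<^sub>M i\<in>{1..d}. borel\<close>.\<close>

definition canonical_basis :: "nat \<Rightarrow> (nat \<Rightarrow> real) set" where
  "canonical_basis d = (\<lambda>i. \<lambda>j\<in>{1..d}. if j = i then 1 else 0) ` {1..d}"

definition increment :: "nat \<Rightarrow> (nat \<Rightarrow> 'a \<Rightarrow> nat \<Rightarrow> real) \<Rightarrow> nat \<Rightarrow> 'a \<Rightarrow> nat \<Rightarrow> real" where
  "increment d B s \<omega> = (\<lambda>i\<in>{1..d}. B (Suc s) \<omega> i - B s \<omega> i)"

definition basis_random_walk ::
  "nat \<Rightarrow> 'a measure \<Rightarrow> (nat \<Rightarrow> 'a \<Rightarrow> nat \<Rightarrow> real) \<Rightarrow> bool" where
  "basis_random_walk d M B \<longleftrightarrow>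
     prob_space M \<and>
     (\<forall>\<omega>\<in>space M. \<forall>i\<in>{1..d}. B 0 \<omega> i = 0) \<and>
     prob_space.indep_vars M (\<lambda>_. \<Pi>\<^sub>M i\<in>{1..d}. borel) (increment d B) UNIV \<and>
     (\<forall>s. distr M (\<Pi>\<^sub>M i\<in>{1..d}. borel) (increment d B s) =
          distr (uniform_count_measure (canonical_basis d)) (\<Pi>\<^sub>M i\<in>{1..d}. borel) (\<lambda>x. x))"

end

theory Submission
  imports Defs "HOL-Combinatorics.Multiset_Permutations"
begin

text \<open>The circuit is diagonal, with phases that are combinations of the Walsh functions
  \<open>walsh n S x = (-1)\<close> to the number of bits of \<open>x\<close> in \<open>S\<close>, so the overlap is the average over
  \<open>x < 2 ^ n\<close> of unit complex numbers. Expanding its \<open>2 t\<close>-th power over pairs of words \<open>xs\<close>, \<open>ys\<close> of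
  length \<open>t\<close> and integrating over the torus, only those pairs survive on which the sums of every
  Walsh function agree. As all non-empty subsets occur (and the empty one is constant), Walsh
  orthogonality forces \<open>ys\<close> to be a rearrangement of \<open>xs\<close>. Hence the frame potential is
  \<open>2 ^ (-2 n t)\<close> times the sum over \<open>xs\<close> of the number of its rearrangements, a multinomial
  coefficient in the letter counts. A uniformly random word has as letter counts the position of
  the random walk at time \<open>t\<close>.\<close>

section \<open>Walsh functions and Pauli-Z strings\<close>

text \<open>The first qubit is the leftmost tensor factor, hence the most significant bit: qubit \<open>m\<close> is
  bit \<open>n - m\<close> of the basis index.\<close>

definition walsh :: "nat \<Rightarrow> nat set \<Rightarrow> nat \<Rightarrow> int" where
  "walsh n S x = (\<Prod>m\<in>S. if bit x (n - m) then -1 else 1)"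

text \<open>Division with remainder by \<open>q\<close> is a bijection of indices: quotient and
  remainder both agree only on the diagonal.\<close>

lemma kron_mat_diag:
  "kron (mat_diag p f) (mat_diag q g) = mat_diag (p * q) (\<lambda>i. f (i div q) * g (i mod q))"
proof (rule eq_matI)
  fix i j assume "i < dim_row (mat_diag (p * q) (\<lambda>i. f (i div q) * g (i mod q)))"
    and "j < dim_col (mat_diag (p * q) (\<lambda>i. f (i div q) * g (i mod q)))"
  then have ij: "i < p * q" "j < p * q" by (auto simp: mat_diag_def)
  then have "q > 0" by (cases q) auto
  then have "i div q < p" "j div q < p" "i mod q < q" "j mod q < q"
    using ij by (auto simp: less_mult_imp_div_less)
  moreover have "i div q = j div q \<and> i mod q = j mod q \<longleftrightarrow> i = j"
    by (metis div_mult_mod_eq)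
  ultimately show "kron (mat_diag p f) (mat_diag q g) $$ (i, j) =
      mat_diag (p * q) (\<lambda>i. f (i div q) * g (i mod q)) $$ (i, j)"
    using ij by (auto simp: kron_def mat_diag_def)
qed (auto simp: kron_def mat_diag_def)

lemma pauli_Z_eq_mat_diag: "pauli_Z = mat_diag 2 (\<lambda>b. if odd b then -1 else 1)"
proof (rule eq_matI)
  fix i j assume "i < dim_row (mat_diag 2 (\<lambda>b. if odd b then -1 else 1 :: complex))"
    and "j < dim_col (mat_diag 2 (\<lambda>b. if odd b then -1 else 1 :: complex))"
  then have "i = 0 \<or> i = 1" "j = 0 \<or> j = 1" by (auto simp: mat_diag_def)
  then show "pauli_Z $$ (i, j) = mat_diag 2 (\<lambda>b. if odd b then -1 else 1) $$ (i, j)"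
    by (elim disjE) (simp_all add: pauli_Z_def mat_diag_def mat_of_rows_list_def)
qed (simp_all add: pauli_Z_def mat_diag_def mat_of_rows_list_def)

text \<open>Passing to suffixes \<open>[m..<n + 1]\<close> makes the induction work:
  \<open>foldr\<close> adds factors on the left, so each step adds one new most significant
  bit.\<close>

lemma pauli_Z_string_suffix:
  assumes "m \<le> n + 1"
  shows "tensor_mats (map (\<lambda>k. if k \<in> S then pauli_Z else 1\<^sub>m 2) [m..<n + 1]) =
         mat_diag (2 ^ (n + 1 - m)) (\<lambda>x. of_int (walsh n (S \<inter> {m..n}) x))"
  using assms
proof (induction m rule: inc_induct)
  case base
  show ?case by (auto simp: tensor_mats_def walsh_def)
next
  case (step m)
  \<comment> \<open>\<open>q\<close> is the dimension of the factors after \<open>m\<close>, and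
    \<open>z\<close> the diagonal of factor \<open>m\<close>. Thus \<open>x div q\<close> exposes
    bit \<open>n - m\<close> of \<open>x\<close>, while \<open>x mod q\<close> retains the lower
    bits, which are those of the later qubits.\<close>
  define q where "q = (2::nat) ^ (n - m)"
  define z :: "nat \<Rightarrow> complex" where "z = (\<lambda>b. if m \<in> S \<and> odd b then -1 else 1)"
  have upt: "[m..<n + 1] = m # [Suc m..<n + 1]"
    using step by (simp add: upt_rec)
  have diag: "(if m \<in> S then pauli_Z else 1\<^sub>m 2) = mat_diag 2 z"
    by (auto simp: pauli_Z_eq_mat_diag z_def)
  have factor: "z (x div q) * of_int (walsh n (S \<inter> {Suc m..n}) (x mod q)) =
      of_int (walsh n (S \<inter> {m..n}) x)" for x
  proof -
    have "bit (x mod q) (n - k) \<longleftrightarrow> bit x (n - k)" if "k \<in> S \<inter> {Suc m..n}" for k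
      using that by (auto simp: q_def bit_take_bit_iff simp flip: take_bit_eq_mod)
    then have "walsh n (S \<inter> {Suc m..n}) (x mod q) = walsh n (S \<inter> {Suc m..n}) x"
      unfolding walsh_def by (intro prod.cong) auto
    moreover have "odd (x div q) \<longleftrightarrow> bit x (n - m)"
      by (simp add: q_def bit_iff_odd)
    moreover have "S \<inter> {m..n} = (if m \<in> S then insert m (S \<inter> {Suc m..n}) else S \<inter> {Suc m..n})"
      using step by (auto simp: Suc_le_eq order.order_iff_strict)
    then have "walsh n (S \<inter> {m..n}) x =
        (if m \<in> S \<and> bit x (n - m) then -1 else 1) * walsh n (S \<inter> {Suc m..n}) x"
      by (simp add: walsh_def)
    ultimately show ?thesis
      by (simp add: z_def)
  qed
  have "2 * q = 2 ^ (n + 1 - m)"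
    using step by (simp add: q_def Suc_diff_le)
  with step.IH show ?case
    by (simp only: upt list.map diag tensor_mats_def foldr.simps o_apply)
       (simp add: kron_mat_diag factor flip: q_def)
qed

lemma pauli_Z_string_eq_mat_diag:
  assumes "S \<subseteq> {1..n}"
  shows "pauli_Z_string n S = mat_diag (2 ^ n) (\<lambda>x. of_int (walsh n S x))"
  using pauli_Z_string_suffix[of 1 n S] assms
  by (simp add: pauli_Z_string_def Int_absorb2 del: upt_Suc)

text \<open>Column orthogonality of the Hadamard matrix. The sum over subsets factorizes into one
  factor per qubit, and a qubit on which \<open>x\<close> and \<open>y\<close> differ contributes
  \<open>-1 + 1 = 0\<close>.\<close>

lemma walsh_orthogonal:
  assumes "x < 2 ^ n" "y < 2 ^ n"
  shows "(\<Sum>S\<in>Pow {1..n}. walsh n S x * walsh n S y) = (if x = y then 2 ^ n else 0)"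
proof -
  define s :: "nat \<Rightarrow> int"
    where "s m = (if bit x (n - m) then -1 else 1) * (if bit y (n - m) then -1 else 1)" for m
  have "(\<Sum>S\<in>Pow {1..n}. walsh n S x * walsh n S y) = (\<Prod>m\<in>{1..n}. s m + 1)"
    by (subst prod_add) (auto simp: walsh_def s_def prod.distrib)
  also have "\<dots> = (if x = y then 2 ^ n else 0)"
  proof (cases "x = y")
    case True
    then have "s m = 1" for m by (simp add: s_def)
    with True show ?thesis by simp
  next
    case False
    then obtain k where k: "bit x k \<noteq> bit y k" by (auto simp: bit_eq_iff)
    \<comment> \<open>Numbers below \<open>2 ^ n\<close> have no bits at positions \<open>n\<close>
      or higher, so the differing bit \<open>k\<close> belongs to an actual qubit, namely
      \<open>n - k\<close>.\<close>
    moreover have "\<not> bit z k" if "k \<ge> n" "z < 2 ^ n" for z :: nat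
    proof -
      have "take_bit n z = z"
        using that by (simp add: take_bit_nat_eq_self)
      then show ?thesis
        using that by (metis bit_take_bit_iff leD)
    qed
    ultimately have "k < n" using assms by (meson not_le)
    then have "n - k \<in> {1..n}" "n - (n - k) = k" by auto
    then have "s (n - k) + 1 = 0" using k by (auto simp: s_def)
    with \<open>n - k \<in> {1..n}\<close> have "(\<Prod>m\<in>{1..n}. s m + 1) = 0"
      by (intro prod_zero bexI[of _ "n - k"]) auto
    then show ?thesis using False by simp
  qed
  finally show ?thesis .
qed

section \<open>Exponentials of diagonal matrices and the overlap of two circuit states\<close>

lemma foldr_mat_diag:
  fixes c :: "'b \<Rightarrow> 'a :: semiring_0"
  assumes "\<And>j. j \<in> set js \<Longrightarrow> A j = mat_diag d (f j)"
  shows "foldr (\<lambda>j B. c j \<cdot>\<^sub>m A j + B) js (0\<^sub>m d d) =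
         mat_diag d (\<lambda>x. \<Sum>j\<leftarrow>js. c j * f j x)"
  using assms
proof (induction js)
  case Nil
  show ?case by (rule eq_matI) (auto simp: mat_diag_def)
next
  case (Cons j js)
  then show ?case by (auto intro!: eq_matI simp: mat_diag_def)
qed

text \<open>Powers of a diagonal matrix are taken entrywise, so its exponential series is the scalar
  one on each diagonal entry and zero elsewhere.\<close>

lemma mat_exp_mat_diag: "mat_exp (mat_diag d f) = mat_diag d (\<lambda>x. exp (f x))"
proof -
  have pow: "mat_diag d f ^\<^sub>m k = mat_diag d (\<lambda>x. f x ^ k)" for k
  proof (induction k)
    case 0
    have "dim_row (mat_diag d f) = d" by (simp add: mat_diag_def)
    then show ?case by simp
  next
    case (Suc k)
    then show ?case by (simp add: mult.commute)
  qed
  have "(\<Sum>k. f x ^ k / fact k) = exp (f x)" for x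
    using exp_converges[of "f x"] by (simp add: sums_iff scaleR_conv_of_real divide_inverse mult.commute)
  then show ?thesis
    unfolding mat_exp_def pow by (auto intro!: eq_matI simp: mat_diag_def)
qed

lemma smult_mat_diag:
  fixes c :: "'a :: semiring_0"
  shows "c \<cdot>\<^sub>m mat_diag d f = mat_diag d (\<lambda>x. c * f x)"
  by (rule eq_matI) (auto simp: mat_diag_def)

text \<open>The eigenvalue of the Hamiltonian (the weighted sum of the Pauli strings) at the basis
  state \<open>x\<close>.\<close>

definition phase :: "nat \<Rightarrow> nat \<Rightarrow> (nat \<Rightarrow> nat set) \<Rightarrow> (nat \<Rightarrow> real) \<Rightarrow> nat \<Rightarrow> real" where
  "phase n N Q \<theta> x = (\<Sum>j\<in>{1..N}. \<theta> j * walsh n (Q j) x)"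

lemma pauli_Z_circuit_eq_mat_diag:
  assumes "\<forall>j\<in>{1..N}. Q j \<subseteq> {1..n}"
  shows "pauli_Z_circuit n N Q \<theta> = mat_diag (2 ^ n) (\<lambda>x. cis (phase n N Q \<theta> x))"
proof -
  have "foldr (\<lambda>j A. complex_of_real (\<theta> j) \<cdot>\<^sub>m pauli_Z_string n (Q j) + A)
         [1..<N + 1] (0\<^sub>m (2 ^ n) (2 ^ n)) =
       mat_diag (2 ^ n) (\<lambda>x. \<Sum>j\<leftarrow>[1..<N + 1]. complex_of_real (\<theta> j) * of_int (walsh n (Q j) x))"
    by (rule foldr_mat_diag, rule pauli_Z_string_eq_mat_diag) (use assms in auto)
  also have "\<dots> = mat_diag (2 ^ n) (\<lambda>x. complex_of_real (phase n N Q \<theta> x))"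
    by (simp add: sum_set_upt_conv_sum_list_nat[symmetric] phase_def atLeastLessThanSuc_atLeastAtMost
        del: upt_Suc)
  finally show ?thesis
    by (simp add: pauli_Z_circuit_def smult_mat_diag mat_exp_mat_diag cis_conv_exp del: upt_Suc)
qed

lemma mat_adjoint_mat_diag:
  fixes f :: "nat \<Rightarrow> complex"
  shows "mat_adjoint (mat_diag d f) = mat_diag d (\<lambda>x. cnj (f x))"
  by (rule eq_matI) (simp_all add: mat_adjoint_def mat_diag_def mat_of_rows_index)

text \<open>The adjoint negates the phases, so only the difference of the parameters enters. All
  basis states have the same weight in the plus state, which turns the bracket into a plain
  average.\<close>

lemma plus_state_overlap:
  assumes "\<forall>j\<in>{1..N}. Q j \<subseteq> {1..n}"
  shows "((mat_adjoint (pauli_Z_circuit n N Q \<theta>) * pauli_Z_circuit n N Q \<theta>') *\<^sub>v plus_state n)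
           \<bullet>c plus_state n
         = (\<Sum>x<2 ^ n. cis (phase n N Q (\<lambda>j. \<theta>' j - \<theta> j) x)) / 2 ^ n"
proof -
  \<comment> \<open>The common amplitude of all basis states; its square is the weight
    \<open>2 ^ (-n)\<close>.\<close>
  define a where "a = complex_of_real (2 powr (- real n / 2))"
  have "a * a = complex_of_real (2 powr (- real n / 2) * 2 powr (- real n / 2))"
    by (simp add: a_def)
  also have "2 powr (- real n / 2) * 2 powr (- real n / 2) = (2::real) powr (- real n)"
    by (subst powr_add[symmetric]) simp
  also have "\<dots> = 1 / 2 ^ n"
    by (simp add: powr_minus_divide powr_realpow)
  also have "complex_of_real \<dots> = 1 / 2 ^ n"
    by simp
  finally have aa: "a * a = 1 / 2 ^ n" .
  have phase_diff: "phase n N Q (\<lambda>j. \<theta>' j - \<theta> j) x = phase n N Q \<theta>' x - phase n N Q \<theta> x" for x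
    by (simp add: phase_def sum_subtractf left_diff_distrib)
  define f where "f x = cis (phase n N Q (\<lambda>j. \<theta>' j - \<theta> j) x)" for x
  have "mat_diag (2 ^ n) f *\<^sub>v plus_state n = Matrix.vec (2 ^ n) (\<lambda>x. f x * a)"
    by (rule eq_vecI)
       (auto simp: mat_diag_def plus_state_def scalar_prod_def a_def if_distrib[of "\<lambda>x. x * _"] cong: if_cong)
  then have "(mat_diag (2 ^ n) f *\<^sub>v plus_state n) \<bullet>c plus_state n = (\<Sum>x<2 ^ n. f x * (a * a))"
    by (simp add: scalar_prod_def plus_state_def a_def lessThan_atLeast0 mult.assoc)
  also have "\<dots> = (\<Sum>x<2 ^ n. f x) / 2 ^ n"
    by (simp add: aa sum_divide_distrib)
  finally have "(mat_diag (2 ^ n) f *\<^sub>v plus_state n) \<bullet>c plus_state n = (\<Sum>x<2 ^ n. f x) / 2 ^ n" .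
  moreover have "mat_adjoint (pauli_Z_circuit n N Q \<theta>) * pauli_Z_circuit n N Q \<theta>' = mat_diag (2 ^ n) f"
    unfolding pauli_Z_circuit_eq_mat_diag[OF assms] mat_adjoint_mat_diag mat_diag_diag
    by (simp add: f_def[abs_def] phase_diff cis_cnj cis_mult)
  ultimately show ?thesis by (simp add: f_def)
qed

section \<open>The frame potential as a count of rearrangements\<close>

text \<open>Expanding the power picks one summand from each of the \<open>t\<close> factors, and
  such a choice is a word of length \<open>t\<close>.\<close>

lemma sum_power_eq_sum_lists:
  fixes f :: "'a \<Rightarrow> 'b :: comm_semiring_1"
  shows "(\<Sum>x\<in>X. f x) ^ t = (\<Sum>xs | set xs \<subseteq> X \<and> length xs = t. \<Prod>x\<leftarrow>xs. f x)"
proof (induction t)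
  case 0
  have "{xs. set xs \<subseteq> X \<and> length xs = 0} = {[]}" by auto
  then show ?case by simp
next
  case (Suc t)
  have "inj_on (\<lambda>(xs, x). x # xs) A" for A :: "('a list \<times> 'a) set"
    by (auto simp: inj_on_def)
  then have "(\<Sum>xs | set xs \<subseteq> X \<and> length xs = Suc t. \<Prod>x\<leftarrow>xs. f x) =
      (\<Sum>(xs, x) \<in> {xs. set xs \<subseteq> X \<and> length xs = t} \<times> X. f x * (\<Prod>x\<leftarrow>xs. f x))"
    unfolding lists_length_Suc_eq by (subst sum.reindex) (simp_all add: case_prod_beta)
  also have "\<dots> = (\<Sum>x\<in>X. f x) ^ Suc t"
    unfolding sum.cartesian_product[symmetric] power_Suc Suc.IH sum_product
    by (rule sum.swap)
  finally show ?case by simp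
qed

section \<open>Fourier integrals over the parameter box\<close>

lemma integral_cis_int:
  fixes k :: int
  shows "integrable lborel (\<lambda>x. indicator {-pi..pi} x *\<^sub>R cis (real_of_int k * x))"
    and "(\<integral>x. indicator {-pi..pi} x *\<^sub>R cis (real_of_int k * x) \<partial>lborel) = (if k = 0 then complex_of_real (2 * pi) else 0)"
proof -
  show "integrable lborel (\<lambda>x. indicator {-pi..pi} x *\<^sub>R cis (real_of_int k * x))"
    by (intro borel_integrable_compact) (auto intro!: continuous_intros)
  show "(\<integral>x. indicator {-pi..pi} x *\<^sub>R cis (real_of_int k * x) \<partial>lborel) = (if k = 0 then complex_of_real (2 * pi) else 0)"
  proof (cases "k = 0")
    case True
    then show ?thesis by (simp add: scaleR_conv_of_real)
  next
    case False
    have "(\<integral>x. indicator {-pi..pi} x *\<^sub>R cis (real_of_int k * x) \<partial>lborel) =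
        cis (k * pi) / (\<i> * k) - cis (k * (- pi)) / (\<i> * k)"
    proof (rule integral_FTC_Icc)
      show "((\<lambda>x. cis (real_of_int k * x) / (\<i> * k)) has_vector_derivative cis (real_of_int k * x)) (at x within {-pi..pi})" for x
        using False
        by (auto intro!: derivative_eq_intros simp: scaleR_conv_of_real field_simps
            has_vector_derivative_def has_derivative_cis)
      show "continuous_on {-pi..pi} (\<lambda>x. cis (real_of_int k * x))"
        by (intro continuous_intros)
    qed simp
    \<comment> \<open>The antiderivative takes the same value at both ends because
      \<open>sin (k * pi)\<close> vanishes for integer \<open>k\<close>.\<close>
    also have "cis (k * (- pi)) = cis (k * pi)"
    proof -
      have "sin (pi * k) = 0" by (auto simp: sin_zero_iff_int2)
      then show ?thesis by (simp add: complex_eq_iff mult.commute)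
    qed
    finally show ?thesis using False by simp
  qed
qed

lemma integral_pair_mult:
  fixes f :: "'a \<Rightarrow> complex" and g :: "'b \<Rightarrow> complex"
  assumes "sigma_finite_measure M1" "sigma_finite_measure M2" "integrable M1 f" "integrable M2 g"
  shows "integrable (M1 \<Otimes>\<^sub>M M2) (\<lambda>(x, y). f x * g y)"
    and "(\<integral>(x, y). f x * g y \<partial>(M1 \<Otimes>\<^sub>M M2)) = integral\<^sup>L M1 f * integral\<^sup>L M2 g"
proof -
  interpret M1: sigma_finite_measure M1 by fact
  interpret M2: sigma_finite_measure M2 by fact
  interpret pair_sigma_finite M1 M2 ..
  note [measurable] = borel_measurable_integrable[OF assms(3)] borel_measurable_integrable[OF assms(4)]
  show int: "integrable (M1 \<Otimes>\<^sub>M M2) (\<lambda>(x, y). f x * g y)"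
    by (rule Fubini_integrable) (use assms in \<open>auto simp: norm_mult\<close>)
  show "(\<integral>(x, y). f x * g y \<partial>(M1 \<Otimes>\<^sub>M M2)) = integral\<^sup>L M1 f * integral\<^sup>L M2 g"
    using integral_fst'[OF int] by simp
qed

text \<open>A character of the torus cut off to the box. Putting the indicator into each factor
  gives a product of one-variable functions, to which integration over the product measure applies
  directly.\<close>

definition box_character :: "nat \<Rightarrow> (nat \<Rightarrow> int) \<Rightarrow> (nat \<Rightarrow> real) \<Rightarrow> complex" where
  "box_character N k \<theta> = (\<Prod>j\<in>{1..N}. indicator {-pi..pi} (\<theta> j) *\<^sub>R cis (k j * \<theta> j))"

lemma integral_box_character:
  shows "integrable (\<Pi>\<^sub>M j\<in>{1..N}. lborel) (box_character N k)"
    and "integral\<^sup>L (\<Pi>\<^sub>M j\<in>{1..N}. lborel) (box_character N k) =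
         (if \<forall>j\<in>{1..N}. k j = 0 then (2 * pi) ^ N else 0)"
proof -
  interpret product_sigma_finite "\<lambda>_. lborel :: real measure" ..
  show "integrable (\<Pi>\<^sub>M j\<in>{1..N}. lborel) (box_character N k)"
    unfolding box_character_def by (intro product_integrable_prod integral_cis_int) simp
  have "integral\<^sup>L (\<Pi>\<^sub>M j\<in>{1..N}. lborel) (box_character N k) =
      (\<Prod>j\<in>{1..N}. if k j = 0 then 2 * pi else 0)"
    unfolding box_character_def
    by (subst product_integral_prod) (simp_all add: integral_cis_int if_distrib cong: if_cong)
  also have "\<dots> = (if \<forall>j\<in>{1..N}. k j = 0 then (2 * pi) ^ N else 0)"
    by (auto intro!: prod_zero)
  finally show "integral\<^sup>L (\<Pi>\<^sub>M j\<in>{1..N}. lborel) (box_character N k) =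
         (if \<forall>j\<in>{1..N}. k j = 0 then (2 * pi) ^ N else 0)" .
qed

text \<open>Points of the product space are \<open>undefined\<close> outside \<open>{1..N}\<close>,
  so that for them membership in the box is decided coordinatewise.\<close>

lemma box_character_eq:
  assumes "\<theta> \<in> space (\<Pi>\<^sub>M j\<in>{1..N}. lborel)"
  shows "box_character N k \<theta> = indicator (param_box N) \<theta> * cis (\<Sum>j\<in>{1..N}. k j * \<theta> j)"
proof -
  have cis: "(\<Prod>j\<in>J. cis (a j)) = cis (\<Sum>j\<in>J. a j)" for J :: "nat set" and a
    by (induction J rule: infinite_finite_induct) (auto simp: cis_mult)
  have "(\<Prod>j\<in>{1..N}. indicator {-pi..pi} (\<theta> j)) = (indicator (param_box N) \<theta> :: complex)"
    using assms by (auto simp: param_box_def indicator_def space_PiM PiE_iff intro!: prod_zero)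
  moreover have "box_character N k \<theta> =
      (\<Prod>j\<in>{1..N}. indicator {-pi..pi} (\<theta> j)) * (\<Prod>j\<in>{1..N}. cis (k j * \<theta> j))"
    unfolding box_character_def prod.distrib[symmetric]
    by (intro prod.cong) (auto simp: indicator_def)
  ultimately show ?thesis by (simp add: cis)
qed

section \<open>Walsh sums determine a word up to rearrangement\<close>

definition walsh_sum :: "nat \<Rightarrow> nat set \<Rightarrow> nat list \<Rightarrow> int" where
  "walsh_sum n S xs = (\<Sum>x\<leftarrow>xs. walsh n S x)"

text \<open>Each word of the expansion contributes one character in the parameters; its integer
  frequency at \<open>j\<close> is the Walsh sum for \<open>Q j\<close>.\<close>

lemma prod_list_cis_phase:
  fixes \<theta> :: "nat \<Rightarrow> real"
  shows "(\<Prod>x\<leftarrow>xs. cis (phase n N Q \<theta> x)) = cis (\<Sum>j\<in>{1..N}. walsh_sum n (Q j) xs * \<theta> j)"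
  by (induction xs) (simp_all add: walsh_sum_def phase_def cis_mult sum.distrib algebra_simps)

text \<open>Walsh inversion: by orthogonality, pairing with the Walsh values at \<open>x\<close>
  retains exactly the letters equal to \<open>x\<close>.\<close>

lemma walsh_sum_Pow_eq_count:
  assumes "set xs \<subseteq> {..<2 ^ n}" "x < 2 ^ n"
  shows "(\<Sum>S\<in>Pow {1..n}. walsh n S x * walsh_sum n S xs) = 2 ^ n * int (count (mset xs) x)"
  using assms(1)
proof (induction xs)
  case Nil
  then show ?case by (simp add: walsh_sum_def)
next
  case (Cons y ys)
  have "(\<Sum>S\<in>Pow {1..n}. walsh n S x * walsh_sum n S (y # ys)) =
      (\<Sum>S\<in>Pow {1..n}. walsh n S x * walsh n S y) + (\<Sum>S\<in>Pow {1..n}. walsh n S x * walsh_sum n S ys)"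
    by (simp add: walsh_sum_def algebra_simps sum.distrib)
  then show ?case
    using Cons assms(2) by (simp add: walsh_orthogonal algebra_simps del: One_nat_def)
qed

text \<open>Inversion recovers all letter counts from the Walsh sums over all subsets. The circuit
  has no rotation for the empty set, but that Walsh sum is the length, which is the same for both
  words.\<close>

lemma mset_eq_iff_walsh_sum:
  assumes "set xs \<subseteq> {..<2 ^ n}" "set ys \<subseteq> {..<2 ^ n}" "length xs = length ys"
  shows "mset xs = mset ys \<longleftrightarrow>
         (\<forall>S. S \<subseteq> {1..n} \<and> S \<noteq> {} \<longrightarrow> walsh_sum n S xs = walsh_sum n S ys)"
proof
  assume "mset xs = mset ys"
  then show "\<forall>S. S \<subseteq> {1..n} \<and> S \<noteq> {} \<longrightarrow> walsh_sum n S xs = walsh_sum n S ys"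
    by (simp add: walsh_sum_def flip: sum_mset_sum_list)
next
  assume *: "\<forall>S. S \<subseteq> {1..n} \<and> S \<noteq> {} \<longrightarrow> walsh_sum n S xs = walsh_sum n S ys"
  have "walsh_sum n {} zs = length zs" for zs
    by (induction zs) (simp_all add: walsh_sum_def walsh_def)
  with * assms(3) have **: "walsh_sum n S xs = walsh_sum n S ys" if "S \<in> Pow {1..n}" for S
    using that by (cases "S = {}") auto
  show "mset xs = mset ys"
  proof (rule multiset_eqI)
    fix x
    show "count (mset xs) x = count (mset ys) x"
    proof (cases "x < 2 ^ n")
      case True
      then have "(2::int) ^ n * int (count (mset xs) x) = 2 ^ n * int (count (mset ys) x)"
        using ** by (simp only: assms flip: walsh_sum_Pow_eq_count cong: sum.cong)
      then show ?thesis by simp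
    next
      case False
      then have "x \<notin> set xs" "x \<notin> set ys" using assms by auto
      then show ?thesis by (metis count_eq_zero_iff set_mset_mset)
    qed
  qed
qed

lemma frame_potential_eq_sum_permutations:
  assumes Q: "bij_betw Q {1..N} {S. S \<subseteq> {1..n} \<and> S \<noteq> {}}"
  shows "frame_potential N (plus_state n) (pauli_Z_circuit n N Q) t =
         1 / 2 ^ (2 * n * t) *
         (\<Sum>xs :: nat list | set xs \<subseteq> {..<2 ^ n} \<and> length xs = t. real (card (permutations_of_multiset (mset xs))))"
proof -
  define L where "L = {xs :: nat list. set xs \<subseteq> {..<2 ^ n} \<and> length xs = t}"
  define P where "P = (\<Pi>\<^sub>M j\<in>{1..N}. (lborel :: real measure))"
  \<comment> \<open>The frequency at \<open>j\<close> of the character that the pair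
    \<open>xs\<close>, \<open>ys\<close> contributes to the expansion.\<close>
  define k where "k xs ys j = walsh_sum n (Q j) xs - walsh_sum n (Q j) ys" for xs ys and j :: nat
  define F where "F \<theta> \<theta>' =
    cmod (((mat_adjoint (pauli_Z_circuit n N Q \<theta>) * pauli_Z_circuit n N Q \<theta>') *\<^sub>v plus_state n)
      \<bullet>c plus_state n) ^ (2 * t)" for \<theta> \<theta>' :: "nat \<Rightarrow> real"
  have Q_sub: "\<forall>j\<in>{1..N}. Q j \<subseteq> {1..n}"
    using Q by (auto dest!: bij_betw_imp_surj_on)
  interpret product_sigma_finite "\<lambda>_. lborel :: real measure" ..
  have sf: "sigma_finite_measure P"
    unfolding P_def by (rule sigma_finite) simp
  have finite_L: "finite L"
    unfolding L_def by (rule finite_lists_length_eq) simp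

  \<comment> \<open>The even power of the modulus is \<open>z ^ t * cnj (z ^ t)\<close>, so each of
    the two factors expands over words. The computation is carried out over the complex numbers
    because the single terms are not real.\<close>
  have F: "complex_of_real (F \<theta> \<theta>') = 1 / 2 ^ (2 * n * t) *
      (\<Sum>xs\<in>L. \<Sum>ys\<in>L. cis (\<Sum>j\<in>{1..N}. k xs ys j * (\<theta>' j - \<theta> j)))" for \<theta> \<theta>' :: "nat \<Rightarrow> real"
  proof -
    define z where "z = (\<Sum>x<2 ^ n. cis (phase n N Q (\<lambda>j. \<theta>' j - \<theta> j) x))"
    define w where "w xs = (\<Sum>j\<in>{1..N}. walsh_sum n (Q j) xs * (\<theta>' j - \<theta> j))" for xs
    have zt: "z ^ t = (\<Sum>xs\<in>L. cis (w xs))"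
      by (simp add: z_def sum_power_eq_sum_lists prod_list_cis_phase L_def w_def)
    have "complex_of_real (F \<theta> \<theta>') = (z / 2 ^ n * cnj (z / 2 ^ n)) ^ t"
      unfolding F_def plus_state_overlap[OF Q_sub] z_def[symmetric] complex_norm_square[symmetric]
      by (simp add: power_mult)
    also have "\<dots> = 1 / 2 ^ (2 * n * t) * (z ^ t * cnj (z ^ t))"
      by (simp add: power_mult_distrib power_divide power_mult[symmetric] mult_2 power_add
          ring_distribs)
    also have "z ^ t * cnj (z ^ t) = (\<Sum>xs\<in>L. \<Sum>ys\<in>L. cis (w xs - w ys))"
      by (simp add: zt sum_product cis_cnj cis_mult)
    finally show ?thesis
      by (simp add: w_def k_def sum_subtractf[symmetric] left_diff_distrib)
  qed

  \<comment> \<open>A character of \<open>\<theta>' - \<theta>\<close> separates into one of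
    opposite frequency in \<open>\<theta>\<close> and one in \<open>\<theta>'\<close>, so the double
    integral of each term is a product.\<close>
  have ind: "complex_of_real (indicator (param_box N \<times> param_box N) (\<theta>, \<theta>') *\<^sub>R F \<theta> \<theta>') =
      1 / 2 ^ (2 * n * t) * (\<Sum>xs\<in>L. \<Sum>ys\<in>L.
         box_character N (\<lambda>j. - k xs ys j) \<theta> * box_character N (k xs ys) \<theta>')"
    if "\<theta> \<in> space P" "\<theta>' \<in> space P" for \<theta> \<theta>' :: "nat \<Rightarrow> real"
  proof -
    have "cis (\<Sum>j\<in>{1..N}. k xs ys j * (\<theta>' j - \<theta> j)) =
       cis (\<Sum>j\<in>{1..N}. (- k xs ys j) * \<theta> j) * cis (\<Sum>j\<in>{1..N}. k xs ys j * \<theta>' j)" for xs ys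
      by (simp add: cis_mult right_diff_distrib sum_subtractf sum_negf)
    then have "indicator (param_box N) \<theta> * indicator (param_box N) \<theta>' *
        cis (\<Sum>j\<in>{1..N}. k xs ys j * (\<theta>' j - \<theta> j)) =
        box_character N (\<lambda>j. - k xs ys j) \<theta> * box_character N (k xs ys) \<theta>'" for xs ys
      using that by (simp add: box_character_eq P_def)
    moreover have "complex_of_real (indicator (param_box N \<times> param_box N) (\<theta>, \<theta>') *\<^sub>R F \<theta> \<theta>') =
       indicator (param_box N) \<theta> * indicator (param_box N) \<theta>' * complex_of_real (F \<theta> \<theta>')"
      by (auto simp: indicator_def)
    ultimately show ?thesis
      by (simp add: F sum_distrib_left mult_ac)
  qed

  have "complex_of_real (set_lebesgue_integral (P \<Otimes>\<^sub>M P) (param_box N \<times> param_box N) (\<lambda>(\<theta>, \<theta>'). F \<theta> \<theta>')) =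
     (\<integral>(\<theta>, \<theta>'). complex_of_real (indicator (param_box N \<times> param_box N) (\<theta>, \<theta>') *\<^sub>R F \<theta> \<theta>') \<partial>(P \<Otimes>\<^sub>M P))"
    by (simp add: set_lebesgue_integral_def case_prod_beta' flip: integral_complex_of_real)
  also have "\<dots> = (\<integral>(\<theta>, \<theta>'). 1 / 2 ^ (2 * n * t) * (\<Sum>xs\<in>L. \<Sum>ys\<in>L.
         box_character N (\<lambda>j. - k xs ys j) \<theta> * box_character N (k xs ys) \<theta>') \<partial>(P \<Otimes>\<^sub>M P))"
    by (rule Bochner_Integration.integral_cong[OF refl])
       (clarsimp simp only: space_pair_measure prod.case mem_Sigma_iff ind)
  also have "\<dots> = 1 / 2 ^ (2 * n * t) * (\<Sum>xs\<in>L. \<Sum>ys\<in>L.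
         (\<integral>(\<theta>, \<theta>'). box_character N (\<lambda>j. - k xs ys j) \<theta> * box_character N (k xs ys) \<theta>' \<partial>(P \<Otimes>\<^sub>M P)))"
  proof -
    have int: "integrable (P \<Otimes>\<^sub>M P)
        (\<lambda>p. box_character N (\<lambda>j. - k xs ys j) (fst p) * box_character N (k xs ys) (snd p))" for xs ys
      using integral_pair_mult(1)[OF sf sf] integral_box_character(1)
      by (simp add: P_def case_prod_beta')
    show ?thesis
      by (simp only: case_prod_beta' integral_mult_right_zero Bochner_Integration.integral_sum int
          Bochner_Integration.integrable_sum)
  qed
  also have "\<dots> = 1 / 2 ^ (2 * n * t) * (\<Sum>xs\<in>L. \<Sum>ys\<in>L.
      if mset ys = mset xs then complex_of_real ((2 * pi) ^ (2 * N)) else 0)"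
  \<comment> \<open>Both integrals vanish unless all frequencies \<open>k xs ys j\<close> are zero.
    As \<open>Q\<close> reaches every non-empty subset, this means that \<open>xs\<close> and
    \<open>ys\<close> are rearrangements of each other.\<close>
  proof -
    have "(\<integral>(\<theta>, \<theta>'). box_character N (\<lambda>j. - k xs ys j) \<theta> * box_character N (k xs ys) \<theta>' \<partial>(P \<Otimes>\<^sub>M P)) =
       (if mset ys = mset xs then complex_of_real ((2 * pi) ^ (2 * N)) else 0)" if "xs \<in> L" "ys \<in> L" for xs ys
    proof -
      have "(\<forall>j\<in>{1..N}. k xs ys j = 0) \<longleftrightarrow> (\<forall>S\<in>Q ` {1..N}. walsh_sum n S xs = walsh_sum n S ys)"
        by (simp add: k_def)
      also have "\<dots> \<longleftrightarrow> mset xs = mset ys"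
        unfolding bij_betw_imp_surj_on[OF Q]
        using that mset_eq_iff_walsh_sum[of xs n ys] by (simp add: L_def)
      finally have "(\<forall>j\<in>{1..N}. k xs ys j = 0) \<longleftrightarrow> mset ys = mset xs" by auto
      moreover have "(2 * complex_of_real pi) ^ N * (2 * pi) ^ N = (2 * pi) ^ (2 * N)"
        unfolding mult_2[of N] power_add by simp
      moreover have "(\<forall>j\<in>{1..N}. - k xs ys j = 0) \<longleftrightarrow> (\<forall>j\<in>{1..N}. k xs ys j = 0)"
        by simp
      ultimately show ?thesis
        unfolding P_def integral_pair_mult(2)[OF sf[unfolded P_def] sf[unfolded P_def]
            integral_box_character(1) integral_box_character(1)] integral_box_character(2)
        by simp
    qed
    then show ?thesis by (simp only: cong: sum.cong)
  qed
  also have "\<dots> = 1 / 2 ^ (2 * n * t) * (\<Sum>xs\<in>L. complex_of_real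
      (card (permutations_of_multiset (mset xs)) * (2 * pi) ^ (2 * N)))"
  proof -
    \<comment> \<open>A rearrangement of a word in \<open>L\<close> has the same letters and length,
      hence lies in \<open>L\<close> again, so no rearrangement is lost.\<close>
    have "{ys \<in> L. mset ys = mset xs} = permutations_of_multiset (mset xs)" if "xs \<in> L" for xs
      using that by (auto simp: L_def permutations_of_multiset_def dest: mset_eq_setD mset_eq_length)
    then show ?thesis
      by (simp add: sum.If_cases finite_L Int_def)
  qed
  also have "\<dots> = complex_of_real (1 / 2 ^ (2 * n * t) * (2 * pi) ^ (2 * N) *
      (\<Sum>xs\<in>L. real (card (permutations_of_multiset (mset xs)))))"
    by (simp add: sum_divide_distrib sum_distrib_left sum_distrib_right mult_ac)
  finally have "set_lebesgue_integral (P \<Otimes>\<^sub>M P) (param_box N \<times> param_box N) (\<lambda>(\<theta>, \<theta>'). F \<theta> \<theta>') =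
     1 / 2 ^ (2 * n * t) * (2 * pi) ^ (2 * N) *
      (\<Sum>xs\<in>L. real (card (permutations_of_multiset (mset xs))))"
    by (simp only: of_real_eq_iff)
  then show ?thesis
    by (simp add: frame_potential_def P_def F_def L_def)
qed

section \<open>The random walk\<close>

text \<open>Coordinates start at 1 and letters at 0, hence the shift. Letters that do not occur
  contribute the factor \<open>fact 0 = 1\<close>.\<close>

lemma multinomial_count:
  fixes xs :: "nat list"
  assumes "set xs \<subseteq> {..<d}" "length xs = t"
  shows "multinomial t {1..d} (\<lambda>i. count (mset xs) (i - 1)) = card (permutations_of_multiset (mset xs))"
proof -
  have "(\<Prod>i\<in>{1..d}. fact (count (mset xs) (i - 1))) = (\<Prod>x\<in>{..<d}. fact (count (mset xs) x) :: nat)"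
    unfolding image_Suc_lessThan[symmetric] by (subst prod.reindex) simp_all
  also have "\<dots> = (\<Prod>x\<in>set_mset (mset xs). fact (count (mset xs) x))"
  proof (rule prod.mono_neutral_right)
    show "\<forall>x\<in>{..<d} - set_mset (mset xs). fact (count (mset xs) x) = (1 :: nat)"
      by (metis DiffD2 count_eq_zero_iff fact_0)
  qed (use assms(1) in auto)
  finally have *: "(\<Prod>i\<in>{1..d}. fact (count (mset xs) (i - 1))) =
      (\<Prod>x\<in>set_mset (mset xs). fact (count (mset xs) x) :: nat)" .
  have "multinomial t {1..d} (\<lambda>i. count (mset xs) (i - 1)) =
      real (fact t) / real (\<Prod>i\<in>{1..d}. fact (count (mset xs) (i - 1)))"
    by (simp add: multinomial_def)
  also have "\<dots> = card (permutations_of_multiset (mset xs))"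
    using card_permutations_of_multiset[of "mset xs"]
    by (simp only: * size_mset assms(2) real_of_nat_div)
  finally show ?thesis .
qed

section \<open>The law of one increment and of the first steps\<close>

definition basis_vector :: "nat \<Rightarrow> nat \<Rightarrow> nat \<Rightarrow> real" where
  "basis_vector d i = (\<lambda>j\<in>{1..d}. if j = i then 1 else 0)"

lemma canonical_basis_eq: "canonical_basis d = basis_vector d ` {1..d}"
  by (simp add: canonical_basis_def basis_vector_def)

lemma inj_on_basis_vector: "inj_on (basis_vector d) {1..d}"
proof (rule inj_onI)
  fix i j assume "i \<in> {1..d}" "j \<in> {1..d}" "basis_vector d i = basis_vector d j"
  then have "i \<in> {1..d}" "basis_vector d i i = basis_vector d j i" by simp_all
  then show "i = j"
    by (auto simp: basis_vector_def split: if_splits)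
qed

lemma sets_basis_vector: "{basis_vector d i} \<in> sets (\<Pi>\<^sub>M j\<in>{1..d}. borel)"
proof -
  have "{basis_vector d i} = (\<Pi>\<^sub>E j\<in>{1..d}. {basis_vector d i j})"
    by (rule PiE_singleton[symmetric]) (simp add: basis_vector_def)
  then show ?thesis
    by (simp only:) (intro sets_PiM_I_finite, auto)
qed

lemma random_walk_prob_space: "basis_random_walk d M B \<Longrightarrow> prob_space M"
  by (simp add: basis_random_walk_def)

lemma measurable_increment:
  assumes "basis_random_walk d M B"
  shows "increment d B s \<in> measurable M (\<Pi>\<^sub>M i\<in>{1..d}. borel)"
proof -
  interpret prob_space M by (rule random_walk_prob_space[OF assms])
  have "indep_vars (\<lambda>_. \<Pi>\<^sub>M i\<in>{1..d}. borel) (increment d B) UNIV"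
    using assms by (simp add: basis_random_walk_def)
  then show ?thesis
    unfolding indep_vars_def by blast
qed

lemma prob_increment:
  assumes "basis_random_walk d M B" "i \<in> {1..d}"
  shows "measure M (increment d B s -` {basis_vector d i} \<inter> space M) = 1 / d"
proof -
  let ?S = "\<Pi>\<^sub>M i\<in>{1..d}. (borel :: real measure)"
  let ?C = "canonical_basis d"
  \<comment> \<open>All subsets of the finite basis are measurable, so measurability of the identity
    only requires that the basis vectors lie in the product space.\<close>
  have id: "(\<lambda>x. x) \<in> measurable (uniform_count_measure ?C) ?S"
    by (rule measurableI)
       (auto simp: space_uniform_count_measure sets_uniform_count_measure canonical_basis_eq
          basis_vector_def space_PiM)
  have "measure M (increment d B s -` {basis_vector d i} \<inter> space M) =
      measure (distr M ?S (increment d B s)) {basis_vector d i}"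
    by (intro measure_distr[symmetric] measurable_increment assms sets_basis_vector)
  also have "\<dots> = measure (distr (uniform_count_measure ?C) ?S (\<lambda>x. x)) {basis_vector d i}"
    using assms(1) by (simp add: basis_random_walk_def)
  also have "\<dots> = measure (uniform_count_measure ?C) ({basis_vector d i} \<inter> ?C)"
    using measure_distr[OF id sets_basis_vector] by (simp add: space_uniform_count_measure)
  also have "{basis_vector d i} \<inter> ?C = {basis_vector d i}"
    using assms(2) by (auto simp: canonical_basis_eq)
  also have "measure (uniform_count_measure ?C) {basis_vector d i} = 1 / d"
    using assms(2) inj_on_basis_vector[of d]
    by (subst measure_uniform_count_measure) (auto simp: canonical_basis_eq card_image)
  finally show ?thesis .
qed

text \<open>The letters of \<open>xs\<close> are shifted by one: the letter \<open>x\<close> stands for the basis vector \<open>x + 1\<close>.\<close>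

definition walk_event ::
  "nat \<Rightarrow> 'a measure \<Rightarrow> (nat \<Rightarrow> 'a \<Rightarrow> nat \<Rightarrow> real) \<Rightarrow> nat list \<Rightarrow> 'a set" where
  "walk_event d M B xs =
     {\<omega> \<in> space M. \<forall>s<length xs. increment d B s \<omega> = basis_vector d (Suc (xs ! s))}"

lemma sets_walk_event:
  assumes "basis_random_walk d M B"
  shows "walk_event d M B xs \<in> sets M"
proof -
  have "{\<omega> \<in> space M. increment d B s \<omega> = basis_vector d i} \<in> sets M" for s i
    using measurable_sets[OF measurable_increment[OF assms] sets_basis_vector[of d i], of s]
    by (simp add: vimage_def Int_def conj_commute)
  then show ?thesis
    unfolding walk_event_def by (intro sets.sets_Collect) auto
qed

text \<open>By independence the steps prescribed by the letters have probability
  \<open>1 / d\<close> each.\<close>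

lemma prob_walk_event:
  assumes walk: "basis_random_walk d M B" and xs: "set xs \<subseteq> {..<d}"
  shows "measure M (walk_event d M B xs) = 1 / d ^ length xs"
\<comment> \<open>For the empty word the intersection below would be \<open>UNIV\<close> instead of
  \<open>space M\<close>, so this case is separate.\<close>
proof (cases "xs = []")
  case True
  then show ?thesis
    using prob_space.prob_space[OF random_walk_prob_space[OF walk]] by (simp add: walk_event_def)
next
  case False
  interpret prob_space M by (rule random_walk_prob_space[OF walk])
  have indep: "indep_vars (\<lambda>_. \<Pi>\<^sub>M i\<in>{1..d}. borel) (increment d B) UNIV"
    using walk by (simp add: basis_random_walk_def)
  have "walk_event d M B xs =
      (\<Inter>s\<in>{..<length xs}. increment d B s -` {basis_vector d (Suc (xs ! s))} \<inter> space M)"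
    using False by (auto simp: walk_event_def)
  also have "prob \<dots> =
      (\<Prod>s\<in>{..<length xs}. prob (increment d B s -` {basis_vector d (Suc (xs ! s))} \<inter> space M))"
    using False by (intro indep_varsD[OF indep]) (auto intro: sets_basis_vector simp del: One_nat_def)
  also have "\<dots> = (\<Prod>s\<in>{..<length xs}. 1 / d)"
  proof (intro prod.cong refl prob_increment[OF walk])
    fix s assume "s \<in> {..<length xs}"
    then have "xs ! s < d" using xs nth_mem by blast
    then show "Suc (xs ! s) \<in> {1..d}" by simp
  qed
  finally show ?thesis by (simp add: power_divide)
qed

text \<open>At any position the increment can equal only one basis vector, so an outcome determines
  its word.\<close>

lemma disjoint_walk_events:
  "disjoint_family_on (walk_event d M B) {xs. set xs \<subseteq> {..<d} \<and> length xs = t}"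
  unfolding disjoint_family_on_def
proof (intro ballI impI, rule ccontr)
  fix xs ys
  assume *: "xs \<in> {xs. set xs \<subseteq> {..<d} \<and> length xs = t}" "ys \<in> {xs. set xs \<subseteq> {..<d} \<and> length xs = t}"
    and "xs \<noteq> ys" "walk_event d M B xs \<inter> walk_event d M B ys \<noteq> {}"
  then obtain \<omega> where \<omega>: "\<omega> \<in> walk_event d M B xs" "\<omega> \<in> walk_event d M B ys" by auto
  have "xs = ys"
  proof (rule nth_equalityI)
    show "length xs = length ys" using * by simp
    fix s assume s: "s < length xs"
    then have "xs ! s \<in> set xs" "ys ! s \<in> set ys" using * by auto
    then have "xs ! s < d" "ys ! s < d" using * by blast+
    moreover have "basis_vector d (Suc (xs ! s)) = basis_vector d (Suc (ys ! s))"
      using \<omega> s * by (auto simp: walk_event_def)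
    ultimately show "xs ! s = ys ! s"
      using inj_onD[OF inj_on_basis_vector, of d "Suc (xs ! s)" "Suc (ys ! s)"] by simp
  qed
  with \<open>xs \<noteq> ys\<close> show False by simp
qed

text \<open>Links the walk to words: each step adds one to the coordinate named by its letter. The
  prefix of length \<open>r\<close> is what makes induction on time possible.\<close>

lemma walk_event_count:
  assumes walk: "basis_random_walk d M B" and \<omega>: "\<omega> \<in> walk_event d M B xs"
    and i: "i \<in> {1..d}" and "r \<le> length xs"
  shows "B r \<omega> i = count (mset (take r xs)) (i - 1)"
  using \<open>r \<le> length xs\<close>
proof (induction r)
  case 0
  then show ?case
    using walk \<omega> i by (simp add: basis_random_walk_def walk_event_def)
next
  case (Suc r)
  have "increment d B r \<omega> i = basis_vector d (Suc (xs ! r)) i"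
    using \<omega> Suc.prems by (simp add: walk_event_def)
  then have "B (Suc r) \<omega> i = B r \<omega> i + (if i = Suc (xs ! r) then 1 else 0)"
    using i by (auto simp: increment_def basis_vector_def)
  then show ?case
    using Suc i by (auto simp: take_Suc_conv_app_nth)
qed

text \<open>A random walk is specified through the laws of its increments, so measurability of the
  position comes from telescoping, with start value 0.\<close>

lemma measurable_walk:
  assumes walk: "basis_random_walk d M B" and i: "i \<in> {1..d}"
  shows "(\<lambda>\<omega>. B t \<omega> i) \<in> borel_measurable M"
proof -
  have "(\<lambda>\<omega>. increment d B s \<omega> i) \<in> borel_measurable M" for s
    using measurable_compose[OF measurable_increment[OF walk] measurable_component_singleton[OF i]] .
  then have "(\<lambda>\<omega>. \<Sum>s<t. increment d B s \<omega> i) \<in> borel_measurable M"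
    by (intro borel_measurable_sum) auto
  moreover have "(\<Sum>s<t. increment d B s \<omega> i) = B t \<omega> i" if "\<omega> \<in> space M" for \<omega>
    using walk i that
    by (simp add: increment_def sum_lessThan_telescope[of "\<lambda>s. B s \<omega> i"] basis_random_walk_def)
  ultimately show ?thesis
    by (subst measurable_cong[where g = "\<lambda>\<omega>. \<Sum>s<t. increment d B s \<omega> i"]) auto
qed

lemma expectation_multinomial_walk:
  assumes walk: "basis_random_walk d M B" and "d \<ge> 1"
  shows "prob_space.expectation M (\<lambda>\<omega>. multinomial t {1..d} (\<lambda>i. nat \<lfloor>B t \<omega> i\<rfloor>)) =
         1 / d ^ t * (\<Sum>xs | set xs \<subseteq> {..<d} \<and> length xs = t.
                        real (card (permutations_of_multiset (mset xs))))"
proof -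
  interpret prob_space M by (rule random_walk_prob_space[OF walk])
  define L where "L = {xs :: nat list. set xs \<subseteq> {..<d} \<and> length xs = t}"
  define E where "E = walk_event d M B"
  define c where "c xs = real (card (permutations_of_multiset (mset xs)))" for xs :: "nat list"
  define X where "X \<omega> = multinomial t {1..d} (\<lambda>i. nat \<lfloor>B t \<omega> i\<rfloor>)" for \<omega>
  have finite_L: "finite L"
    unfolding L_def by (rule finite_lists_length_eq) simp
  have E_sets [measurable]: "E xs \<in> events" for xs
    unfolding E_def by (rule sets_walk_event[OF walk])
  have disj: "disjoint_family_on E L"
    unfolding E_def L_def by (rule disjoint_walk_events)
  have prob_E: "prob (E xs) = 1 / d ^ t" if "xs \<in> L" for xs
    using that prob_walk_event[OF walk, of xs] by (auto simp: E_def L_def)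
  \<comment> \<open>The \<open>d ^ t\<close> disjoint events have probability
    \<open>1 / d ^ t\<close> each, so they exhaust the space up to a null set.\<close>
  have "prob (\<Union>xs\<in>L. E xs) = (\<Sum>xs\<in>L. prob (E xs))"
    using finite_L disj by (intro finite_measure_finite_Union) auto
  also have "\<dots> = 1"
    using assms(2) by (simp add: prob_E) (simp add: L_def card_lists_length_eq)
  finally have AE_E: "AE \<omega> in M. \<omega> \<in> (\<Union>xs\<in>L. E xs)"
    by (rule AE_prob_1)
  \<comment> \<open>On the event of \<open>xs\<close> the coordinates are natural numbers, so
    \<open>nat\<close> and the floor change nothing.\<close>
  have X_E: "X \<omega> = c xs" if "xs \<in> L" "\<omega> \<in> E xs" for xs \<omega>
  proof -
    have "X \<omega> = multinomial t {1..d} (\<lambda>i. count (mset xs) (i - 1))"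
      unfolding X_def multinomial_def
      using that walk_event_count[OF walk, of \<omega> xs _ t] by (simp add: E_def L_def)
    then show ?thesis
      using that multinomial_count[of xs d t] by (simp add: c_def L_def)
  qed
  have AE_X: "AE \<omega> in M. X \<omega> = (\<Sum>xs\<in>L. indicator (E xs) \<omega> * c xs)"
    using AE_E
  proof eventually_elim
    case (elim \<omega>)
    then obtain xs where xs: "xs \<in> L" "\<omega> \<in> E xs" by auto
    have "(\<Sum>ys\<in>L. indicator (E ys) \<omega> * c ys) = (\<Sum>ys\<in>L. if ys = xs then c xs else 0)"
      using disj xs by (intro sum.cong) (auto simp: disjoint_family_on_def indicator_def)
    then show ?case using xs X_E finite_L by simp
  qed
  \<comment> \<open>\<open>X\<close> agrees with a simple function only almost everywhere, so its
    own measurability has to be shown before the integrals can be equated.\<close>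
  have X_meas: "X \<in> borel_measurable M"
  proof -
    have [measurable]: "(\<lambda>\<omega>. B t \<omega> i) \<in> borel_measurable M" if "i \<in> {1..d}" for i
      using measurable_walk[OF walk that] .
    have "(\<lambda>\<omega>. fact (nat \<lfloor>B t \<omega> i\<rfloor>) :: real) \<in> borel_measurable M" if "i \<in> {1..d}" for i
      using that by measurable
    then show ?thesis
      unfolding X_def multinomial_def by (intro borel_measurable_divide borel_measurable_prod) auto
  qed
  have "expectation X = expectation (\<lambda>\<omega>. \<Sum>xs\<in>L. indicator (E xs) \<omega> * c xs)"
    by (rule integral_cong_AE[OF X_meas _ AE_X]) measurable
  also have "\<dots> = (\<Sum>xs\<in>L. prob (E xs) * c xs)"
    by (subst Bochner_Integration.integral_sum)
       (auto intro!: integrable_mult_left integrable_real_indicator simp: emeasure_eq_measure)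
  also have "\<dots> = 1 / d ^ t * (\<Sum>xs\<in>L. c xs)"
    by (simp add: prob_E sum_divide_distrib)
  finally show ?thesis by (simp add: X_def[abs_def] c_def L_def)
qed

theorem theorem5:
  fixes n N t :: nat
    and Q :: "nat \<Rightarrow> nat set"
    and M :: "'a measure"
    and B :: "nat \<Rightarrow> 'a \<Rightarrow> nat \<Rightarrow> real"
  assumes "n \<ge> 1"
    and "N = 2 ^ n - 1"
    and "bij_betw Q {1..N} {S. S \<subseteq> {1..n} \<and> S \<noteq> {}}"
    and "t \<ge> 1"
    and "basis_random_walk (2 ^ n) M B"
  shows "frame_potential N (plus_state n) (pauli_Z_circuit n N Q) t =
         1 / 2 ^ (n * t) *
         prob_space.expectation M (\<lambda>\<omega>. multinomial t {1..2 ^ n} (\<lambda>i. nat \<lfloor>B t \<omega> i\<rfloor>))"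
proof -
  have "real (2 ^ n) ^ t = 2 ^ (n * t)"
    by (simp add: power_mult)
  then have "prob_space.expectation M (\<lambda>\<omega>. multinomial t {1..2 ^ n} (\<lambda>i. nat \<lfloor>B t \<omega> i\<rfloor>)) =
      1 / 2 ^ (n * t) * (\<Sum>xs :: nat list | set xs \<subseteq> {..<2 ^ n} \<and> length xs = t.
        real (card (permutations_of_multiset (mset xs))))"
    using expectation_multinomial_walk[OF assms(5)] by simp
  \<comment> \<open>One factor \<open>1 / 2 ^ (n * t)\<close> is the probability of a word and is
    absorbed by the expectation; the other remains in front.\<close>
  moreover have "(2::real) ^ (2 * n * t) = 2 ^ (n * t) * 2 ^ (n * t)"
    by (simp add: mult_2 distrib_right flip: power_add)
  ultimately show ?thesis
    unfolding frame_potential_eq_sum_permutations[OF assms(3)] by simp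
qed

end
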